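(* Let $\mathcal{Z}\in\mathbb{R}^{I_1\times I_2\times I_3}$ be a third-order tensor, $R=\min\{I_1,I_2\}$, $\bar\Lambda\in\mathbb{R}^{R\times I_3}_{\ge0}$, and $\gamma>0,\varepsilon>0$. Then the weighted tensor $L\gamma$-norm $$\|\mathcal{Z}\|_{L,\gamma,\bar\Lambda}=\sum_{i=1}^{I_3}\sum_{j=1}^{R}f_{L,\gamma,\bar\Lambda_{j,i}}\left(\sigma_j(\bar{\mathcal{Z}}^{(i)})\right)$$ is obtained equivalently as $$\|\mathcal{Z}\|_{L,\gamma,\bar\Lambda}=\min_{W\in\mathbb{R}^{R\times I_3}_{\ge0}}\left\{\|\mathcal{Z}\|_{L,W}+\frac{\gamma}{2}\|W-\bar\Lambda\|_{F}^{2}\right\},$$ where $$\|\mathcal{Z}\|_{L,W}=\sum_{i=1}^{I_3}\sum_{j=1}^{R}W_{j,i}\log\left(\frac{\sigma_j(\bar{\mathcal{Z}}^{(i)})}{\varepsilon}+1\right).$$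
   Context: $\bar{\mathcal{Z}}$ denotes the (unnormalized) discrete Fourier transform of $\mathcal{Z}$ along its third mode, $\bar{\mathcal{Z}}^{(i)}\in\mathbb{C}^{I_1\times I_2}$ is its $i$-th frontal slice, and $\sigma_j(\cdot)$ is the $j$-th largest singular value of a matrix. $\|\cdot\|_F$ is the Frobenius norm. For scalars $\lambda\ge 0$, $\gamma>0$, $\varepsilon>0$, the MLCP function is $$f_{L,\gamma,\lambda}(z)=\begin{cases}\lambda\log\left(\frac{|z|}{\varepsilon}+1\right)-\frac{1}{2\gamma}\log^{2}\left(\frac{|z|}{\varepsilon}+1\right), & |z|\le \varepsilon e^{\gamma\lambda}-\varepsilon,\\[2pt] \frac{\gamma\lambda^{2}}{2}, & |z|>\varepsilon e^{\gamma\lambda}-\varepsilon.\end{cases}$$ *)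

theory Defs
  imports
    "HOL-Analysis.Analysis"
    "Jordan_Normal_Form.Schur_Decomposition"
begin

text \<open>
  A third-order tensor of size n1 x n2 x n3 is given by the list of its n3 frontal slices, so
  its (a, b, k) entry is \<open>(Z ! k) $$ (a, b)\<close>.  All indices start at 0.
\<close>

definition tensor3 :: "nat \<Rightarrow> nat \<Rightarrow> nat \<Rightarrow> 'a mat list set" where
  "tensor3 n1 n2 n3 = {Z. length Z = n3 \<and> (\<forall>k<n3. Z ! k \<in> carrier_mat n1 n2)}"

definition dft3 :: "real mat list \<Rightarrow> complex mat list" where
  "dft3 Z = map (\<lambda>i. mat (dim_row (Z ! i)) (dim_col (Z ! i))
      (\<lambda>(a, b). \<Sum>k<length Z. complex_of_real ((Z ! k) $$ (a, b)) *
          exp (- 2 * complex_of_real pi * \<i> * of_nat i * of_nat k / of_nat (length Z))))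
    [0..<length Z]"

text \<open>
  The singular values of an m x n matrix A, in decreasing order: square roots of the
  min m n largest eigenvalues of the Gram matrix (A adjoint times A), counted with multiplicity.
  These eigenvalues are real and nonnegative, so \<open>Re\<close> loses nothing; if m < n, the values
  dropped by \<open>take\<close> are zeros.
\<close>

definition singular_values :: "complex mat \<Rightarrow> real list" where
  "singular_values A = take (min (dim_row A) (dim_col A))
    (rev (sorted_list_of_multiset
      (image_mset (\<lambda>x. sqrt (Re x)) (proots (char_poly (mat_adjoint A * A))))))"

text \<open>\<open>sing_val A j\<close> is the singular value with zero-based position j in decreasing order.\<close>

definition sing_val :: "complex mat \<Rightarrow> nat \<Rightarrow> real" where
  "sing_val A j = singular_values A ! j"

definition frob_norm :: "real mat \<Rightarrow> real" where
  "frob_norm A = sqrt (\<Sum>i<dim_row A. \<Sum>j<dim_col A. (A $$ (i, j))\<^sup>2)"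

definition nonneg_mats :: "nat \<Rightarrow> nat \<Rightarrow> real mat set" where
  "nonneg_mats m n = {W \<in> carrier_mat m n. \<forall>i<m. \<forall>j<n. 0 \<le> W $$ (i, j)}"

definition mlcp :: "real \<Rightarrow> real \<Rightarrow> real \<Rightarrow> real \<Rightarrow> real" where
  "mlcp \<epsilon> \<gamma> c z =
    (if \<bar>z\<bar> \<le> \<epsilon> * exp (\<gamma> * c) - \<epsilon>
     then c * ln (\<bar>z\<bar> / \<epsilon> + 1) - 1 / (2 * \<gamma>) * (ln (\<bar>z\<bar> / \<epsilon> + 1))\<^sup>2
     else \<gamma> * c\<^sup>2 / 2)"

definition weighted_L\<gamma>_norm :: "real \<Rightarrow> real \<Rightarrow> real mat \<Rightarrow> real mat list \<Rightarrow> real" where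
  "weighted_L\<gamma>_norm \<epsilon> \<gamma> \<Lambda> Z =
    (\<Sum>i<length Z. \<Sum>j<min (dim_row (Z ! i)) (dim_col (Z ! i)).
      mlcp \<epsilon> \<gamma> (\<Lambda> $$ (j, i)) (sing_val (dft3 Z ! i) j))"

definition weighted_L_norm :: "real \<Rightarrow> real mat \<Rightarrow> real mat list \<Rightarrow> real" where
  "weighted_L_norm \<epsilon> W Z =
    (\<Sum>i<length Z. \<Sum>j<min (dim_row (Z ! i)) (dim_col (Z ! i)).
      W $$ (j, i) * ln (sing_val (dft3 Z ! i) j / \<epsilon> + 1))"

text \<open>\<open>Min\<close> is only meaningful on finite sets.\<close>

definition is_minimum_of :: "real \<Rightarrow> real set \<Rightarrow> bool" where
  "is_minimum_of m S \<longleftrightarrow> m \<in> S \<and> (\<forall>s\<in>S. m \<le> s)"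

end

theory Submission
  imports Defs
begin

text \<open>
  Singular values are nonnegative, so each \<open>t = ln (\<sigma> / \<epsilon> + 1)\<close> is nonnegative. The objective
  separates over the entries of \<open>W\<close>, and completing the square shows that
  \<open>w * t + \<gamma> / 2 * (w - c)\<^sup>2\<close> is minimal over \<open>w \<ge> 0\<close> at \<open>w = max 0 (c - t / \<gamma>)\<close>, where its
  value is the MLCP function; the two branches of the latter correspond to \<open>t \<le> \<gamma> * c\<close>
  and \<open>t > \<gamma> * c\<close>.
\<close>

lemma mat_adjoint_eq: "mat_adjoint A = transpose_mat (map_mat conjugate A)"
  by (rule eq_matI) (auto simp: mat_adjoint_def mat_of_rows_def)

lemma conjugate_mult_mat_vec:
  fixes A :: "'a :: conjugatable_ring mat"
  assumes "A \<in> carrier_mat m n" "v \<in> carrier_vec n"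
  shows "conjugate (A *\<^sub>v v) = map_mat conjugate A *\<^sub>v conjugate v"
proof (rule eq_vecI)
  fix i assume "i < dim_vec (map_mat conjugate A *\<^sub>v conjugate v)"
  then have i: "i < m" using assms by simp
  have "row (map_mat conjugate A) i = conjugate (row A i)"
    using assms i by (intro eq_vecI) auto
  moreover have "conjugate (row A i \<bullet> v) = conjugate (row A i) \<bullet> conjugate v"
    using assms i by (intro conjugate_sprod_vec[of _ n]) auto
  ultimately show "conjugate (A *\<^sub>v v) $ i = (map_mat conjugate A *\<^sub>v conjugate v) $ i"
    using assms i by simp
qed (use assms in simp)

text \<open>Conjugation passes through the product with v, which leaves the transpose rule for the
  entrywise conjugate of A.\<close>

lemma cscalar_prod_mat_adjoint:
  fixes A :: "'a :: conjugatable_field mat"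
  assumes A: "A \<in> carrier_mat m n" and u: "u \<in> carrier_vec m" and v: "v \<in> carrier_vec n"
  shows "(mat_adjoint A *\<^sub>v u) \<bullet>c v = u \<bullet>c (A *\<^sub>v v)"
  unfolding mat_adjoint_eq conjugate_mult_mat_vec[OF A v]
  using A u v by (intro transpose_vec_mult_scalar) auto

text \<open>For an eigenvector v, moving the adjoint across gives |A v|^2 = x |v|^2, where the left
  side is nonnegative and |v|^2 is positive.\<close>

lemma eigenvalue_gram_nonneg:
  assumes A: "(A :: complex mat) \<in> carrier_mat m n" and ev: "eigenvalue (mat_adjoint A * A) x"
  shows "0 \<le> Re x"
proof -
  have adj: "mat_adjoint A \<in> carrier_mat n m"
    using A by (simp add: mat_adjoint_eq)
  obtain v where v: "v \<in> carrier_vec n" "v \<noteq> 0\<^sub>v n" and eq: "(mat_adjoint A * A) *\<^sub>v v = x \<cdot>\<^sub>v v"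
    using ev adj A by (auto simp: eigenvalue_def eigenvector_def)
  have "(A *\<^sub>v v) \<bullet>c (A *\<^sub>v v) = ((mat_adjoint A * A) *\<^sub>v v) \<bullet>c v"
    using A adj v by (subst assoc_mult_mat_vec[OF adj A v(1)]) (simp add: cscalar_prod_mat_adjoint[OF A])
  also have "\<dots> = x * (v \<bullet>c v)"
    using v by (simp add: eq)
  finally have xv: "x * (v \<bullet>c v) \<ge> 0"
    using conjugate_square_ge_0_vec[of "A *\<^sub>v v"] by simp
  have "v \<bullet>c v > 0"
    using v by simp
  \<comment> \<open>The order on complex numbers compares only numbers with equal imaginary parts,
    so |v|^2 is real here and the sign passes to \<open>Re x\<close>.\<close>
  with xv show ?thesis
    by (auto simp: less_eq_complex_def less_complex_def zero_le_mult_iff)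
qed

text \<open>Over the complex numbers the characteristic polynomial has as many roots, with
  multiplicity, as A has columns, so \<open>take\<close> never runs short. This keeps the indexing
  in \<open>sing_val\<close> within range.\<close>

lemma length_singular_values:
  "length (singular_values A) = min (dim_row A) (dim_col A)"
proof -
  have "mat_adjoint A * A \<in> carrier_mat (dim_col A) (dim_col A)"
    by (auto simp: mat_adjoint_eq)
  moreover have "length (sorted_list_of_multiset M) = size M" for M :: "real multiset"
    by (metis mset_sorted_list_of_multiset size_mset)
  ultimately show ?thesis
    by (simp add: singular_values_def size_proots_complex degree_monic_char_poly)
qed

text \<open>\<open>sqrt\<close> is an odd function on all reals, so nonnegativity has to come from
  the eigenvalues of the Gram matrix.\<close>

lemma singular_values_nonneg:
  assumes "s \<in> set (singular_values A)"
  shows "0 \<le> s"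
proof -
  let ?G = "mat_adjoint A * A"
  have G: "?G \<in> carrier_mat (dim_col A) (dim_col A)"
    by (auto simp: mat_adjoint_eq)
  then have "char_poly ?G \<noteq> 0"
    using degree_monic_char_poly[OF G] by auto
  then obtain x where x: "s = sqrt (Re x)" "poly (char_poly ?G) x = 0"
    using assms unfolding singular_values_def by (auto dest!: in_set_takeD)
  then show ?thesis
    using eigenvalue_gram_nonneg[of A "dim_row A" "dim_col A" x] eigenvalue_root_char_poly[OF G]
    by auto
qed

lemma sing_val_nonneg:
  assumes "j < min (dim_row A) (dim_col A)"
  shows "0 \<le> sing_val A j"
  using assms by (auto simp: sing_val_def length_singular_values intro!: singular_values_nonneg nth_mem)

text \<open>Taking logarithms turns the threshold on z into a linear one on t, the form in which the
  square can be completed.\<close>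

lemma mlcp_eq_ln:
  assumes "0 < \<epsilon>" "0 < \<gamma>" "0 \<le> z" and t: "t = ln (z / \<epsilon> + 1)"
  shows "mlcp \<epsilon> \<gamma> c z = (if t \<le> \<gamma> * c then c * t - t\<^sup>2 / (2 * \<gamma>) else \<gamma> * c\<^sup>2 / 2)"
proof -
  have "0 < z / \<epsilon> + 1"
    using assms by (simp add: add_nonneg_pos)
  then have "t \<le> \<gamma> * c \<longleftrightarrow> z / \<epsilon> + 1 \<le> exp (\<gamma> * c)"
    unfolding t by (metis exp_le_cancel_iff exp_ln)
  also have "\<dots> \<longleftrightarrow> z \<le> \<epsilon> * exp (\<gamma> * c) - \<epsilon>"
    using assms by (simp add: field_simps)
  finally show ?thesis
    using assms by (simp add: mlcp_def)
qed

lemma mlcp_le: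
  assumes "0 < \<epsilon>" "0 < \<gamma>" "0 \<le> z" "0 \<le> w" "0 \<le> c"
  shows "mlcp \<epsilon> \<gamma> c z \<le> w * ln (z / \<epsilon> + 1) + \<gamma> / 2 * (w - c)\<^sup>2"
proof -
  define t where "t = ln (z / \<epsilon> + 1)"
  show ?thesis
  proof (cases "t \<le> \<gamma> * c")
    case True
    \<comment> \<open>The gap is a perfect square that vanishes at w = c - t / \<gamma>.\<close>
    have "w * t + \<gamma> / 2 * (w - c)\<^sup>2 - (c * t - t\<^sup>2 / (2 * \<gamma>)) = \<gamma> / 2 * (w - c + t / \<gamma>)\<^sup>2"
      using assms by (simp add: field_simps power2_eq_square)
    moreover have "0 \<le> \<gamma> / 2 * (w - c + t / \<gamma>)\<^sup>2"
      using assms by simp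
    ultimately have "c * t - t\<^sup>2 / (2 * \<gamma>) \<le> w * t + \<gamma> / 2 * (w - c)\<^sup>2"
      by linarith
    then show ?thesis
      using True assms by (simp add: mlcp_eq_ln[OF _ _ _ t_def] t_def[symmetric])
  next
    case False
    \<comment> \<open>Here c - t / \<gamma> is negative, hence not admissible as a weight. The bound
      now rests on w being nonnegative, and the gap vanishes at w = 0.\<close>
    then have "0 \<le> w * (t - \<gamma> * c)"
      using assms by simp
    moreover have "w * t + \<gamma> / 2 * (w - c)\<^sup>2 - \<gamma> * c\<^sup>2 / 2 = w * (t - \<gamma> * c) + \<gamma> / 2 * w\<^sup>2"
      by (simp add: field_simps power2_eq_square)
    moreover have "0 \<le> \<gamma> / 2 * w\<^sup>2"
      using assms by simp
    ultimately have "\<gamma> * c\<^sup>2 / 2 \<le> w * t + \<gamma> / 2 * (w - c)\<^sup>2"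
      by linarith
    then show ?thesis
      using False assms by (simp add: mlcp_eq_ln[OF _ _ _ t_def] t_def[symmetric])
  qed
qed

lemma mlcp_attained:
  assumes "0 < \<epsilon>" "0 < \<gamma>" "0 \<le> z" and w: "w = max 0 (c - ln (z / \<epsilon> + 1) / \<gamma>)"
  shows "mlcp \<epsilon> \<gamma> c z = w * ln (z / \<epsilon> + 1) + \<gamma> / 2 * (w - c)\<^sup>2"
proof -
  define t where "t = ln (z / \<epsilon> + 1)"
  show ?thesis
  proof (cases "t \<le> \<gamma> * c")
    case True
    then have "w = c - t / \<gamma>"
      using assms by (simp add: max_def field_simps t_def)
    then show ?thesis
      using True assms(1-3)
      by (simp add: mlcp_eq_ln[OF _ _ _ t_def] t_def[symmetric])
        (simp add: field_simps power2_eq_square)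
  next
    case False
    then have "w = 0"
      using assms by (simp add: max_def field_simps t_def)
    then show ?thesis
      using False assms(1-3) by (simp add: mlcp_eq_ln[OF _ _ _ t_def])
  qed
qed

theorem theorem7:
  fixes I1 I2 I3 :: nat and Z :: "real mat list" and \<Lambda> :: "real mat" and \<gamma> \<epsilon> :: real
  assumes "Z \<in> tensor3 I1 I2 I3"
    and "\<Lambda> \<in> nonneg_mats (min I1 I2) I3"
    and "\<gamma> > 0" and "\<epsilon> > 0"
  shows "is_minimum_of (weighted_L\<gamma>_norm \<epsilon> \<gamma> \<Lambda> Z)
    ((\<lambda>W. weighted_L_norm \<epsilon> W Z + \<gamma> / 2 * (frob_norm (W - \<Lambda>))\<^sup>2) ` nonneg_mats (min I1 I2) I3)"
proof -
  let ?R = "min I1 I2"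
  define s where "s i j = sing_val (dft3 Z ! i) j" for i j
  have dim: "dim_row (Z ! i) = I1" "dim_col (Z ! i) = I2" if "i < I3" for i
    using assms(1) that by (auto simp: tensor3_def)
  have len: "length Z = I3"
    using assms(1) by (simp add: tensor3_def)
  have \<Lambda>_nonneg: "0 \<le> \<Lambda> $$ (j, i)" if "j < ?R" "i < I3" for i j
    using assms(2) that by (auto simp: nonneg_mats_def)
  have \<Lambda>: "\<Lambda> \<in> carrier_mat ?R I3"
    using assms(2) by (simp add: nonneg_mats_def)
  have s_nonneg: "0 \<le> s i j" if "i < I3" "j < ?R" for i j
    using that unfolding s_def by (intro sing_val_nonneg) (simp add: dft3_def len dim)
  have lhs: "weighted_L\<gamma>_norm \<epsilon> \<gamma> \<Lambda> Z = (\<Sum>i<I3. \<Sum>j<?R. mlcp \<epsilon> \<gamma> (\<Lambda> $$ (j, i)) (s i j))"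
    unfolding weighted_L\<gamma>_norm_def s_def len by (simp add: dim)
  have rhs: "weighted_L_norm \<epsilon> W Z + \<gamma> / 2 * (frob_norm (W - \<Lambda>))\<^sup>2 =
      (\<Sum>i<I3. \<Sum>j<?R. W $$ (j, i) * ln (s i j / \<epsilon> + 1) + \<gamma> / 2 * (W $$ (j, i) - \<Lambda> $$ (j, i))\<^sup>2)"
    if "W \<in> carrier_mat ?R I3" for W
  proof -
    \<comment> \<open>\<open>frob_norm\<close> sums over rows j first, the tensor norms over slices
      i first. After the swap both parts of the objective merge into one double sum, whose terms
      each involve a single entry of W.\<close>
    have "(frob_norm (W - \<Lambda>))\<^sup>2 = (\<Sum>j<?R. \<Sum>i<I3. ((W - \<Lambda>) $$ (j, i))\<^sup>2)"
      using \<Lambda> by (simp add: frob_norm_def sum_nonneg)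
    also have "\<dots> = (\<Sum>i<I3. \<Sum>j<?R. (W $$ (j, i) - \<Lambda> $$ (j, i))\<^sup>2)"
      using \<Lambda> by (subst sum.swap) (intro sum.cong, auto)
    finally show ?thesis
      unfolding weighted_L_norm_def s_def len
      by (simp add: dim sum.distrib sum_distrib_left)
  qed
  \<comment> \<open>Since the entries do not interact, the scalar minimisers, clipped at 0, assemble
    into one admissible matrix that minimises every term at once.\<close>
  define W where "W = mat ?R I3 (\<lambda>(j, i). max 0 (\<Lambda> $$ (j, i) - ln (s i j / \<epsilon> + 1) / \<gamma>))"
  have W: "W \<in> carrier_mat ?R I3" "W \<in> nonneg_mats ?R I3"
    by (auto simp: W_def nonneg_mats_def)
  have "weighted_L\<gamma>_norm \<epsilon> \<gamma> \<Lambda> Z = weighted_L_norm \<epsilon> W Z + \<gamma> / 2 * (frob_norm (W - \<Lambda>))\<^sup>2"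
    unfolding lhs rhs[OF W(1)]
    using assms(3,4) s_nonneg by (intro sum.cong refl mlcp_attained) (auto simp: W_def)
  moreover have "weighted_L\<gamma>_norm \<epsilon> \<gamma> \<Lambda> Z \<le> weighted_L_norm \<epsilon> V Z + \<gamma> / 2 * (frob_norm (V - \<Lambda>))\<^sup>2"
    if "V \<in> nonneg_mats ?R I3" for V
  proof -
    have V: "V \<in> carrier_mat ?R I3" "\<And>i j. i < I3 \<Longrightarrow> j < ?R \<Longrightarrow> 0 \<le> V $$ (j, i)"
      using that by (auto simp: nonneg_mats_def)
    show ?thesis
      unfolding lhs rhs[OF V(1)]
      using assms(3,4) s_nonneg \<Lambda>_nonneg V(2) by (intro sum_mono mlcp_le) auto
  qed
  ultimately show ?thesis
    using W by (auto simp: is_minimum_of_def)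
qed

end
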